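(* For every $a, b \in \Lambda_{\mathrm{dB}}$ and every $n \in \mathbb{N}_{>0}$, $$a\{\!\{n \leftarrow b\}\!\} \;=\; \big(\mathrm{SW}_1^{\,n-1}(a)\big)\big[\mathrm{INC}^{\,n-1}(b)\big].$$
   Context: $\Lambda_{\mathrm{dB}}$ is the set of de Bruijn terms given by $a ::= n \mid a\,a \mid \lambda a$ with $n \in \mathbb{N}_{>0}$. Updating: for $k\in\mathbb{N}$, $i\in\mathbb{N}_{>0}$, $U^i_k(n)=n$ if $n\le k$ and $U^i_k(n)=n+i-1$ if $n>k$; $U^i_k(a\,b)=U^i_k(a)\,U^i_k(b)$; $U^i_k(\lambda a)=\lambda U^i_{k+1}(a)$. de Bruijn meta-substitution: $m\{\!\{n\leftarrow c\}\!\}$ equals $m$ if $m<n$, $U^n_0(c)$ if $m=n$, and $m-1$ if $m>n$; $(a\,b)\{\!\{n\leftarrow c\}\!\}=a\{\!\{n\leftarrow c\}\!\}\,b\{\!\{n\leftarrow c\}\!\}$; $(\lambda a)\{\!\{n\leftarrow c\}\!\}=\lambda\,(a\{\!\{n+1\leftarrow c\}\!\})$. Increment: for $i\in\mathbb{N}$, $\mathrm{inc}_i(n)=n$ if $n\le i$ and $n+1$ if $n>i$; $\mathrm{inc}_i(a\,b)=\mathrm{inc}_i(a)\,\mathrm{inc}_i(b)$; $\mathrm{inc}_i(\lambda a)=\lambda\,\mathrm{inc}_{i+1}(a)$. Swap: for $i\in\mathbb{N}_{>0}$, $\mathrm{sw}_i(n)=n$ if $n<i$ or $n>i+1$, $\mathrm{sw}_i(i)=i+1$,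 $\mathrm{sw}_i(i+1)=i$; $\mathrm{sw}_i(a\,b)=\mathrm{sw}_i(a)\,\mathrm{sw}_i(b)$; $\mathrm{sw}_i(\lambda a)=\lambda\,\mathrm{sw}_{i+1}(a)$. $\lambda r$ meta-substitution $a[c]$: $1[c]=c$, $n[c]=n-1$ for $n>1$; $(a\,b)[c]=a[c]\,b[c]$; $(\lambda a)[c]=\lambda\big(\mathrm{sw}_1(a)[\mathrm{inc}_0(c)]\big)$. Stacked swap: for $i\in\mathbb{N}_{>0}$, $j\in\mathbb{N}$, $\mathrm{SW}_i^0(a)=a$ and $\mathrm{SW}_i^j(a)=\mathrm{SW}_i^{j-1}(\mathrm{sw}_{i+j-1}(a))$ for $j>0$ (so $\mathrm{SW}_i^j(a)=\mathrm{sw}_i(\mathrm{sw}_{i+1}(\cdots\mathrm{sw}_{i+j-1}(a)\cdots))$). Stacked increment: for $i\in\mathbb{N}$, $\mathrm{INC}^0(a)=a$ and $\mathrm{INC}^i(a)=\mathrm{INC}^{i-1}(\mathrm{inc}_0(a))$ for $i>0$ (i.e. $i$ applications of $\mathrm{inc}_0$). *)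

theory Defs
  imports Main
begin

text \<open>
  Indices are natural numbers; the set \<open>Lambda_dB\<close> cuts out the terms all of whose
  indices are positive. The operations below are total on the raw datatype, and their
  values at index 0 are irrelevant.
\<close>

datatype dB = Var nat | App dB dB | Lam dB

inductive_set Lambda_dB :: "dB set" where
  Var: "n > 0 \<Longrightarrow> Var n \<in> Lambda_dB"
| App: "a \<in> Lambda_dB \<Longrightarrow> b \<in> Lambda_dB \<Longrightarrow> App a b \<in> Lambda_dB"
| Lam: "a \<in> Lambda_dB \<Longrightarrow> Lam a \<in> Lambda_dB"

text \<open>\<open>upd i k a\<close> is $U^i_k(a)$, for \<open>i > 0\<close>.\<close>

primrec upd :: "nat \<Rightarrow> nat \<Rightarrow> dB \<Rightarrow> dB" where
  "upd i k (Var n) = (if n \<le> k then Var n else Var (n + i - 1))"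
| "upd i k (App a b) = App (upd i k a) (upd i k b)"
| "upd i k (Lam a) = Lam (upd i (k + 1) a)"

text \<open>\<open>msubst a n c\<close> is $a\{\!\{n \leftarrow c\}\!\}$, for \<open>n > 0\<close>.\<close>

primrec msubst :: "dB \<Rightarrow> nat \<Rightarrow> dB \<Rightarrow> dB" where
  "msubst (Var m) n c =
     (if m < n then Var m else if m = n then upd n 0 c else Var (m - 1))"
| "msubst (App a b) n c = App (msubst a n c) (msubst b n c)"
| "msubst (Lam a) n c = Lam (msubst a (n + 1) c)"

primrec inc :: "nat \<Rightarrow> dB \<Rightarrow> dB" where
  "inc i (Var n) = (if n \<le> i then Var n else Var (n + 1))"
| "inc i (App a b) = App (inc i a) (inc i b)"
| "inc i (Lam a) = Lam (inc (i + 1) a)"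

primrec sw :: "nat \<Rightarrow> dB \<Rightarrow> dB" where
  "sw i (Var n) =
     (if n = i then Var (i + 1) else if n = i + 1 then Var i else Var n)"
| "sw i (App a b) = App (sw i a) (sw i b)"
| "sw i (Lam a) = Lam (sw (i + 1) a)"

lemma size_sw [simp]: "size (sw i a) = size a"
  by (induction a arbitrary: i) simp_all

text \<open>\<open>rsubst a c\<close> is $a[c]$; the recursion is not structural, since it passes through
  \<open>sw 1 a\<close> under an abstraction.\<close>

function rsubst :: "dB \<Rightarrow> dB \<Rightarrow> dB" where
  "rsubst (Var n) c = (if n = 1 then c else Var (n - 1))"
| "rsubst (App a b) c = App (rsubst a c) (rsubst b c)"
| "rsubst (Lam a) c = Lam (rsubst (sw 1 a) (inc 0 c))"
  by pat_completeness auto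
termination
  by (relation "measure (\<lambda>(a, c). size a)") auto

text \<open>\<open>SW i j\<close> is $\mathrm{SW}_i^j$; the index \<open>i + j\<close> below is $i + (j + 1) - 1$.\<close>

fun SW :: "nat \<Rightarrow> nat \<Rightarrow> dB \<Rightarrow> dB" where
  "SW i 0 a = a"
| "SW i (Suc j) a = SW i j (sw (i + j) a)"

fun INC :: "nat \<Rightarrow> dB \<Rightarrow> dB" where
  "INC 0 a = a"
| "INC (Suc i) a = INC i (inc 0 a)"

end

(* Commuting past a lambda shifts the stack of swaps from SW 1 (n - 1) to SW 2 (n - 1); the
   swap sw 1 introduced by rsubst completes it to SW 1 n, while inc 0 extends the stack of
   increments. So structural induction on the term applies directly, with n and b generalised.
   At a variable, the stack of swaps is the cycle bringing n to position 1. *)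
theory Submission
  imports Defs
begin

lemma SW_App: "SW i j (App a b) = App (SW i j a) (SW i j b)"
  by (induction j arbitrary: a b) simp_all

lemma SW_Lam: "SW i j (Lam a) = Lam (SW (Suc i) j a)"
  by (induction j arbitrary: a) simp_all

lemma SW_Var:
  "SW i j (Var m) =
     (if i \<le> m \<and> m < i + j then Var (Suc m) else if m = i + j then Var i else Var m)"
  by (induction j arbitrary: m) auto

text \<open>\<open>SW\<close> recurses on the innermost swap, whereas \<open>rsubst\<close> adds an
  outermost one under an abstraction.\<close>

lemma sw_SW_Suc: "sw i (SW (Suc i) j a) = SW i (Suc j) a"
  by (induction j arbitrary: a) simp_all

lemma inc_INC: "inc 0 (INC j a) = INC (Suc j) a"
  by (induction j arbitrary: a) simp_all

lemma upd_1: "upd (Suc 0) k a = a"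
  by (induction a arbitrary: k) simp_all

lemma inc_upd: "inc k (upd (Suc i) k a) = upd (Suc (Suc i)) k a"
  by (induction a arbitrary: k) simp_all

text \<open>\<open>upd i\<close> shifts by i - 1, hence \<open>Suc j\<close> for j
  increments.\<close>

lemma INC_eq_upd: "INC j a = upd (Suc j) 0 a"
proof (induction j)
  case 0
  show ?case by (simp add: upd_1)
next
  case (Suc j)
  show ?case by (simp only: inc_INC [symmetric] Suc inc_upd)
qed

lemma msubst_Suc_eq_rsubst:
  assumes "a \<in> Lambda_dB"
  shows "msubst a (Suc k) b = rsubst (SW 1 k a) (INC k b)"
  using assms
proof (induction arbitrary: k b)
  case (Var m)
  \<comment> \<open>For 0 < m <= k the swaps raise m and \<open>rsubst\<close> lowers it back; m =
    \<open>Suc k\<close> becomes 1 and is replaced by \<open>INC k b\<close>; a larger m is only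
    lowered.\<close>
  then show ?case by (auto simp: SW_Var INC_eq_upd)
next
  case (App a1 a2)
  then show ?case by (simp add: SW_App)
next
  case (Lam a)
  have "msubst (Lam a) (Suc k) b = Lam (rsubst (SW 1 (Suc k) a) (INC (Suc k) b))"
    by (simp only: msubst.simps Suc_eq_plus1 [symmetric] Lam.IH)
  then show ?case
    by (simp only: SW_Lam rsubst.simps One_nat_def sw_SW_Suc inc_INC)
qed

theorem theorem1:
  fixes a b :: dB and n :: nat
  assumes "a \<in> Lambda_dB" and "b \<in> Lambda_dB" and "n > 0"
  shows "msubst a n b = rsubst (SW 1 (n - 1) a) (INC (n - 1) b)"
  using msubst_Suc_eq_rsubst [OF assms(1), of "n - 1" b] assms(3) by simp

end
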